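(* Let $G$ be a (simple, possibly infinite) connected graph which is weakly $2$-locally $\mathbb{L}^2$. Then there exists a normal covering map from $\mathbb{L}^2$ to $G$.
   Context: Graphs are simple, not necessarily finite. $\mathbb{L}^d$ is the graph with vertex set $\mathbb{Z}^d$ and edges $\{x,x+e_i\}$ for $x\in\mathbb{Z}^d$, $i\in\{1,\dots,d\}$, where $e_i$ is the $i$th unit vector. For a graph $G$ and vertex $v$, $d_G$ is graph distance; $\mathrm{Link}^-_r(v,G)$ is the subgraph of $G$ consisting of all vertices at distance at most $r$ from $v$ and all edges $xy$ with $\min\{d_G(v,x),d_G(v,y)\}<r$. $G$ is weakly $r$-locally $\mathbb{L}^d$ if for every vertex $v$ of $G$ there is a graph isomorphism $\phi:\mathrm{Link}^-_r(0,\mathbb{L}^d)\to \mathrm{Link}^-_r(v,G)$ with $\phi(0)=v$. A covering map from $F$ to $G$ is a graph homomorphism $p:V(F)\to V(G)$ mapping the neighbour set of each $v$ bijectively onto the neighbour set of $p(v)$. A covering transformation of $p$ is an automorphism $\phi$ of $F$ with $p\circ\phi=p$; $p$ is normal if the group of covering transformations acts transitively on each fibre $p^{-1}(w)$. *)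

theory Defs
  imports "HOL-Analysis.Finite_Cartesian_Product" "HOL-Library.Numeral_Type" "Graph_Theory.Graph_Theory"
begin

text \<open>
  Simple, not necessarily finite graphs are represented as loop-free symmetric pair digraphs
  (locale \<^locale>\<open>pair_bidirected_digraph\<close>): an edge \<open>xy\<close> is the pair of arcs \<open>(x, y)\<close>, \<open>(y, x)\<close>.
\<close>

text \<open>
  The distance is the infimum of the lengths of all walks, hence \<open>\<infinity>\<close> between different components.
\<close>

definition graph_dist :: "'a pair_pre_digraph \<Rightarrow> 'a \<Rightarrow> 'a \<Rightarrow> ereal" where
  "graph_dist G u v = wf_digraph.\<mu> (with_proj G) (\<lambda>_. 1) u v"

lemma graph_dist_le_iff:
  assumes "pair_bidirected_digraph G"
  shows "graph_dist G u v \<le> ereal (real r) \<longleftrightarrow>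
    (\<exists>p. pre_digraph.awalk (with_proj G) u p v \<and> length p \<le> r)"
proof -
  interpret pair_bidirected_digraph G by fact
  have wf: "wf_digraph (with_proj G)" ..
  have cost: "wf_digraph.awalk_cost (\<lambda>_. 1) p = real (length p)" for p :: "('a \<times> 'a) list"
    by (induction p) (simp_all add: wf_digraph.awalk_cost_Nil[OF wf] wf_digraph.awalk_cost_Cons[OF wf])
  have dist: "graph_dist G u v = (INF p\<in>{p. awalk u p v}. ereal (real (length p)))"
    unfolding graph_dist_def wf_digraph.\<mu>_def[OF wf] cost ..
  show ?thesis
  proof
    assume "\<exists>p. awalk u p v \<and> length p \<le> r"
    then obtain p where "awalk u p v" "length p \<le> r" by blast
    then have "graph_dist G u v \<le> ereal (real (length p))"
      unfolding dist by (intro INF_lower) simp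
    also have "\<dots> \<le> ereal (real r)" using \<open>length p \<le> r\<close> by simp
    finally show "graph_dist G u v \<le> ereal (real r)" .
  next
    assume le: "graph_dist G u v \<le> ereal (real r)"
    show "\<exists>p. awalk u p v \<and> length p \<le> r"
    proof (rule ccontr)
      assume "\<not> ?thesis"
      then have "ereal (real (Suc r)) \<le> graph_dist G u v"
        unfolding dist by (intro INF_greatest) (auto simp: not_le Suc_le_eq)
      from this le have "ereal (real (Suc r)) \<le> ereal (real r)" by (rule order_trans)
      then show False by simp
    qed
  qed
qed

definition graph_isomorphism ::
  "'a pair_pre_digraph \<Rightarrow> 'b pair_pre_digraph \<Rightarrow> ('a \<Rightarrow> 'b) \<Rightarrow> bool" where
  "graph_isomorphism F G \<phi> \<longleftrightarrow>
     bij_betw \<phi> (pverts F) (pverts G) \<and>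
     (\<forall>x\<in>pverts F. \<forall>y\<in>pverts F. (x, y) \<in> parcs F \<longleftrightarrow> (\<phi> x, \<phi> y) \<in> parcs G)"

definition graph_homomorphism ::
  "'a pair_pre_digraph \<Rightarrow> 'b pair_pre_digraph \<Rightarrow> ('a \<Rightarrow> 'b) \<Rightarrow> bool" where
  "graph_homomorphism F G p \<longleftrightarrow>
     p ` pverts F \<subseteq> pverts G \<and> (\<forall>(x, y)\<in>parcs F. (p x, p y) \<in> parcs G)"

definition neighbours :: "'a pair_pre_digraph \<Rightarrow> 'a \<Rightarrow> 'a set" where
  "neighbours G v = {w. (v, w) \<in> parcs G}"

definition lattice_graph :: "(int ^ 'd::finite) pair_pre_digraph" where
  "lattice_graph = \<lparr>pverts = UNIV,
     parcs = {(x, y). \<exists>i. y = x + axis i 1 \<or> x = y + axis i 1}\<rparr>"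

definition link_minus :: "nat \<Rightarrow> 'a \<Rightarrow> 'a pair_pre_digraph \<Rightarrow> 'a pair_pre_digraph" where
  "link_minus r v G = \<lparr>pverts = {x \<in> pverts G. graph_dist G v x \<le> ereal (real r)},
     parcs = {(x, y) \<in> parcs G. min (graph_dist G v x) (graph_dist G v y) < ereal (real r)}\<rparr>"

text \<open>The dimension \<open>d\<close> of the lattice is the cardinality of the index type \<open>'d\<close>.\<close>

definition weakly_locally_lattice ::
  "'d::finite itself \<Rightarrow> nat \<Rightarrow> 'a pair_pre_digraph \<Rightarrow> bool" where
  "weakly_locally_lattice _ r G \<longleftrightarrow>
     (\<forall>v\<in>pverts G. \<exists>\<phi>.
        graph_isomorphism (link_minus r 0 (lattice_graph :: (int ^ 'd) pair_pre_digraph))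
          (link_minus r v G) \<phi> \<and> \<phi> 0 = v)"

definition covering_map ::
  "'a pair_pre_digraph \<Rightarrow> 'b pair_pre_digraph \<Rightarrow> ('a \<Rightarrow> 'b) \<Rightarrow> bool" where
  "covering_map F G p \<longleftrightarrow> graph_homomorphism F G p \<and>
     (\<forall>v\<in>pverts F. bij_betw p (neighbours F v) (neighbours G (p v)))"

definition covering_transformation ::
  "'a pair_pre_digraph \<Rightarrow> ('a \<Rightarrow> 'b) \<Rightarrow> ('a \<Rightarrow> 'a) \<Rightarrow> bool" where
  "covering_transformation F p \<phi> \<longleftrightarrow>
     graph_isomorphism F F \<phi> \<and> (\<forall>v\<in>pverts F. p (\<phi> v) = p v)"

definition normal_covering_map ::
  "'a pair_pre_digraph \<Rightarrow> 'b pair_pre_digraph \<Rightarrow> ('a \<Rightarrow> 'b) \<Rightarrow> bool" where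
  "normal_covering_map F G p \<longleftrightarrow> covering_map F G p \<and>
     (\<forall>w\<in>pverts G. \<forall>u\<in>pverts F. \<forall>v\<in>pverts F. p u = w \<and> p v = w \<longrightarrow>
        (\<exists>\<phi>. covering_transformation F p \<phi> \<and> \<phi> u = v))"

lemma pair_bidirected_digraph_lattice_graph:
  "pair_bidirected_digraph (lattice_graph :: (int ^ 'd::finite) pair_pre_digraph)"
proof
  show "symmetric (lattice_graph :: (int ^ 'd) pair_pre_digraph)"
    by (auto simp: lattice_graph_def symmetric_def sym_def)
next
  fix e assume "e \<in> parcs (lattice_graph :: (int ^ 'd) pair_pre_digraph)"
  then show "fst e \<noteq> snd e"
    by (auto simp: lattice_graph_def)
qed (simp_all add: lattice_graph_def)

end

(* Two neighbours a, b of a vertex v are opposite if v is their only common neighbour;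
   otherwise they are perpendicular and have exactly one further common neighbour, the fourth
   corner of a square. A frame is a vertex with two perpendicular neighbours. Stepping along the
   first or the second neighbour, and completing the new frame by the opposite of the old vertex and
   the corner, gives two commuting permutations of the frames. Their powers develop an initial
   frame into a map of the lattice into the frames, whose base points are the covering map. A
   development is determined by its value at one point, and reflecting or swapping the directions of
   a frame corresponds to a lattice symmetry; hence of two lattice points over the same vertex, one
   is moved to the other by a covering transformation. *)
theory Submission
  imports Defs "HOL-Analysis.Cartesian_Space"
begin

section \<open>The square lattice in coordinates\<close>

abbreviation "e1 \<equiv> axis 1 1 :: int ^ 2"
abbreviation "e2 \<equiv> axis 2 1 :: int ^ 2"

lemma axis_nth_2 [simp]: "e1 $ 1 = 1" "e1 $ 2 = 0" "e2 $ 1 = 0" "e2 $ 2 = 1"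
  by (simp_all add: axis_def)

lemma vec_eq_2: "x = y \<longleftrightarrow> x $ 1 = y $ 1 \<and> x $ 2 = y $ 2" for x y :: "'b ^ 2"
  by (simp add: vec_eq_iff forall_2)

definition pt :: "int \<Rightarrow> int \<Rightarrow> int ^ 2" where
  "pt m n = (\<chi> i. if i = 1 then m else n)"

lemma pt_nth [simp]: "pt m n $ 1 = m" "pt m n $ 2 = n"
  by (simp_all add: pt_def)

text \<open>Integer induction runs along the horizontal axis first and then up and down each
  column.\<close>

lemma lattice_induct [case_names zero right left up down]:
  fixes z :: "int ^ 2"
  assumes "P 0"
    and "\<And>z. P z \<Longrightarrow> P (z + e1)" "\<And>z. P z \<Longrightarrow> P (z - e1)"
    and "\<And>z. P z \<Longrightarrow> P (z + e2)" "\<And>z. P z \<Longrightarrow> P (z - e2)"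
  shows "P z"
proof -
  have "P (pt m 0)" for m
  proof (induction m rule: int_induct[where k = 0])
    case base
    have "pt 0 0 = 0" by (simp add: vec_eq_2)
    with assms(1) show ?case by simp
  next
    case (step1 i)
    have "pt (i + 1) 0 = pt i 0 + e1" by (simp add: vec_eq_2)
    with assms(2) step1 show ?case by simp
  next
    case (step2 i)
    have "pt (i - 1) 0 = pt i 0 - e1" by (simp add: vec_eq_2)
    with assms(3) step2 show ?case by simp
  qed
  then have "P (pt m n)" for m n
  proof (induction n rule: int_induct[where k = 0])
    case (step1 i)
    have "pt m (i + 1) = pt m i + e2" by (simp add: vec_eq_2)
    with assms(4) step1 show ?case by simp
  next
    case (step2 i)
    have "pt m (i - 1) = pt m i - e2" by (simp add: vec_eq_2)
    with assms(5) step2 show ?case by simp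
  qed simp
  moreover have "z = pt (z $ 1) (z $ 2)" by (simp add: vec_eq_2)
  ultimately show ?thesis by metis
qed

text \<open>Adjacency as l1-distance one lets linear arithmetic decide questions about
  edges.\<close>

lemma lattice_arc_iff:
  "(x, y) \<in> parcs (lattice_graph :: (int ^ 2) pair_pre_digraph) \<longleftrightarrow>
    \<bar>y $ 1 - x $ 1\<bar> + \<bar>y $ 2 - x $ 2\<bar> = 1"
proof -
  have "(\<exists>i. P i) \<longleftrightarrow> P 1 \<or> P 2" for P :: "2 \<Rightarrow> bool"
    by (metis exhaust_2)
  then show ?thesis by (simp add: lattice_graph_def vec_eq_2) arith
qed

lemma neighbours_lattice:
  "neighbours (lattice_graph :: (int ^ 2) pair_pre_digraph) z = {z + e1, z - e1, z + e2, z - e2}"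
  unfolding neighbours_def set_eq_iff by (simp add: lattice_arc_iff vec_eq_2) arith

abbreviation "lattice_neighbours \<equiv> neighbours (lattice_graph :: (int ^ 2) pair_pre_digraph)"

text \<open>This is the model for the assumption \<open>local_structure\<close> of the locale
  \<open>local_grid\<close>; link isomorphisms carry it over to \<open>G\<close>.\<close>

lemma lattice_local_structure:
  assumes "e \<in> lattice_neighbours 0"
  obtains f where "lattice_neighbours 0 = {e, f, - e, - f}" "distinct [e, f, - e, - f]"
    "lattice_neighbours e \<inter> lattice_neighbours f = {0, e + f}" "e + f \<noteq> 0"
    "lattice_neighbours e \<inter> lattice_neighbours (- e) = {0}"
    "lattice_neighbours e \<inter> lattice_neighbours (- f) = {0, e - f}" "e - f \<noteq> 0"
proof -
  have "e \<in> {e1, - e1, e2, - e2}"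
    using assms by (simp add: neighbours_lattice)
  \<comment> \<open>In all four cases \<open>f\<close> is \<open>e\<close> turned by a quarter turn
    in the same sense.\<close>
  then obtain f where "e = e1 \<and> f = e2 \<or> e = - e1 \<and> f = - e2 \<or> e = e2 \<and> f = - e1 \<or> e = - e2 \<and> f = e1"
    by blast
  then have "lattice_neighbours 0 = {e, f, - e, - f}" "distinct [e, f, - e, - f]"
    "lattice_neighbours e \<inter> lattice_neighbours f = {0, e + f}" "e + f \<noteq> 0"
    "lattice_neighbours e \<inter> lattice_neighbours (- e) = {0}"
    "lattice_neighbours e \<inter> lattice_neighbours (- f) = {0, e - f}" "e - f \<noteq> 0"
    by (elim disjE conjE; simp add: neighbours_lattice Int_insert_left vec_eq_2; auto simp: vec_eq_2)+
  then show thesis by (rule that)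
qed

section \<open>Integer powers of a permutation of a set\<close>

text \<open>
  Meant for a map \<open>g\<close> that is inverse to \<open>f\<close> on the points of interest only.
\<close>

definition int_pow :: "('b \<Rightarrow> 'b) \<Rightarrow> ('b \<Rightarrow> 'b) \<Rightarrow> int \<Rightarrow> 'b \<Rightarrow> 'b" where
  "int_pow f g n = (if 0 \<le> n then f ^^ nat n else g ^^ nat (- n))"

lemma funpow_closed: "f \<in> X \<rightarrow> X \<Longrightarrow> x \<in> X \<Longrightarrow> (f ^^ n) x \<in> X"
  by (induction n) auto

lemma int_pow_closed: "f \<in> X \<rightarrow> X \<Longrightarrow> g \<in> X \<rightarrow> X \<Longrightarrow> x \<in> X \<Longrightarrow> int_pow f g n x \<in> X"
  by (simp add: int_pow_def funpow_closed)

lemma int_pow_plus_1: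
  assumes "g \<in> X \<rightarrow> X" "\<And>x. x \<in> X \<Longrightarrow> f (g x) = x" "x \<in> X"
  shows "int_pow f g (n + 1) x = f (int_pow f g n x)"
proof (cases "0 \<le> n")
  case True
  then show ?thesis by (simp add: int_pow_def nat_add_distrib)
next
  case False
  \<comment> \<open>Writing the exponent as \<open>- int (Suc k)\<close> exposes an outermost
    \<open>g\<close>, which \<open>f\<close> cancels.\<close>
  then obtain k where "n = - int (Suc k)"
    by (cases n rule: int_cases) auto
  moreover have "(g ^^ k) x \<in> X" using assms by (simp add: funpow_closed)
  ultimately show ?thesis using assms(2) by (auto simp: int_pow_def nat_add_distrib)
qed

lemma int_pow_commute:
  assumes "f \<in> X \<rightarrow> X" "g \<in> X \<rightarrow> X" "h \<in> X \<rightarrow> X"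
    and "\<And>x. x \<in> X \<Longrightarrow> g (f x) = x" "\<And>x. x \<in> X \<Longrightarrow> f (g x) = x"
    and "\<And>x. x \<in> X \<Longrightarrow> h (f x) = f (h x)" and "x \<in> X"
  shows "int_pow f g n (h x) = h (int_pow f g n x)"
proof -
  \<comment> \<open>A map that commutes with \<open>f\<close> commutes with its inverse, so negative
    powers need no separate assumption.\<close>
  have gh: "h (g x) = g (h x)" if "x \<in> X" for x
  proof -
    have "g x \<in> X" "h (g x) \<in> X" using assms(2,3) that by auto
    then have "h (g x) = g (f (h (g x)))" using assms(4) by simp
    also have "\<dots> = g (h (f (g x)))" using assms(6) \<open>g x \<in> X\<close> by simp
    finally show ?thesis using assms(5) that by simp
  qed
  have "(f ^^ k) (h x) = h ((f ^^ k) x)" for k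
    using assms by (induction k) (simp_all add: funpow_closed)
  moreover have "(g ^^ k) (h x) = h ((g ^^ k) x)" for k
    using assms gh by (induction k) (simp_all add: funpow_closed)
  ultimately show ?thesis by (simp add: int_pow_def)
qed

section \<open>Automorphisms of the lattice\<close>

abbreviation lattice_automorphism :: "(int ^ 2 \<Rightarrow> int ^ 2) \<Rightarrow> bool" where
  "lattice_automorphism \<equiv> graph_isomorphism lattice_graph lattice_graph"

lemma pverts_lattice [simp]: "pverts lattice_graph = UNIV"
  by (simp add: lattice_graph_def)

lemma graph_isomorphism_comp:
  assumes "graph_isomorphism F G \<phi>" "graph_isomorphism G H \<psi>"
  shows "graph_isomorphism F H (\<lambda>x. \<psi> (\<phi> x))"
proof -
  have "\<phi> x \<in> pverts G" if "x \<in> pverts F" for x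
    using assms(1) that by (auto simp: graph_isomorphism_def bij_betw_def)
  then show ?thesis
    using assms bij_betw_trans[of \<phi> "pverts F" "pverts G" \<psi> "pverts H"] by (simp add: graph_isomorphism_def comp_def)
qed

lemma lattice_automorphism_translate: "lattice_automorphism (\<lambda>z. z + u)"
  unfolding graph_isomorphism_def by (simp add: lattice_arc_iff bij_plus_right)

lemma lattice_automorphism_swap: "lattice_automorphism (\<lambda>z. pt (z $ 2) (z $ 1))"
  unfolding graph_isomorphism_def
  by (auto simp: lattice_arc_iff vec_eq_2 intro!: involuntory_imp_bij)

lemma lattice_automorphism_flip: "lattice_automorphism (\<lambda>z. pt (- z $ 1) (z $ 2))"
  unfolding graph_isomorphism_def
  by (auto simp: lattice_arc_iff vec_eq_2 intro!: involuntory_imp_bij)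

section \<open>Opposite neighbours, corners and frames\<close>

text \<open>In the local structure at \<open>v\<close>, \<open>c\<close> lies opposite \<open>a\<close>, while \<open>b\<close> and \<open>d\<close> are perpendicular to it.\<close>

locale local_grid =
  fixes V :: "'a set" and N :: "'a \<Rightarrow> 'a set"
  assumes N_closed: "v \<in> V \<Longrightarrow> a \<in> N v \<Longrightarrow> a \<in> V"
    and N_sym: "a \<in> N v \<Longrightarrow> v \<in> N a"
    and N_nonempty: "v \<in> V \<Longrightarrow> N v \<noteq> {}"
    and local_structure: "v \<in> V \<Longrightarrow> a \<in> N v \<Longrightarrow> \<exists>b c d. distinct [a, b, c, d] \<and> N v = {a, b, c, d} \<and>
      N a \<inter> N c = {v} \<and> (\<exists>x. x \<noteq> v \<and> N a \<inter> N b = {v, x}) \<and> (\<exists>x. x \<noteq> v \<and> N a \<inter> N d = {v, x})"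
begin

definition opp :: "'a \<Rightarrow> 'a \<Rightarrow> 'a" where
  "opp v a = (THE b. b \<in> N v \<and> b \<noteq> a \<and> N a \<inter> N b = {v})"

definition corner :: "'a \<Rightarrow> 'a \<Rightarrow> 'a \<Rightarrow> 'a" where
  "corner v a b = (THE x. x \<noteq> v \<and> x \<in> N a \<inter> N b)"

definition frame :: "'a \<Rightarrow> 'a \<Rightarrow> 'a \<Rightarrow> bool" where
  "frame v a b \<longleftrightarrow> v \<in> V \<and> a \<in> N v \<and> b \<in> N v \<and> a \<noteq> b \<and> (\<exists>x. x \<noteq> v \<and> x \<in> N a \<inter> N b)"

text \<open>Of the three other neighbours of \<open>v\<close>, the two perpendicular ones share a
  second neighbour with \<open>a\<close>, so only \<open>c\<close> qualifies.\<close>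

lemma opp_ex1:
  assumes "v \<in> V" "a \<in> N v"
  shows "\<exists>!b. b \<in> N v \<and> b \<noteq> a \<and> N a \<inter> N b = {v}"
proof -
  obtain b c d where "distinct [a, b, c, d]" "N v = {a, b, c, d}" "N a \<inter> N c = {v}"
    "N a \<inter> N b \<noteq> {v}" "N a \<inter> N d \<noteq> {v}"
    using local_structure[OF assms] by blast
  then show ?thesis by (intro ex1I[of _ c]) auto
qed

lemma opp:
  assumes "v \<in> V" "a \<in> N v"
  shows "opp v a \<in> N v" "opp v a \<noteq> a" "N a \<inter> N (opp v a) = {v}"
  using theI'[OF opp_ex1[OF assms], folded opp_def] by blast+

lemma opp_eqI:
  assumes "v \<in> V" "a \<in> N v" "b \<in> N v" "b \<noteq> a" "N a \<inter> N b = {v}"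
  shows "opp v a = b"
  using opp_ex1[OF assms(1,2)] opp[OF assms(1,2)] assms by blast

lemma opp_opp: "v \<in> V \<Longrightarrow> a \<in> N v \<Longrightarrow> opp v (opp v a) = a"
  using opp opp(2)[symmetric] by (intro opp_eqI) (simp_all add: Int_commute)

text \<open>Since \<open>v\<close> is itself a common neighbour of \<open>a\<close> and
  \<open>b\<close>, a second one exists exactly if \<open>N a \<inter> N b\<close> differs from
  \<open>{v}\<close>. The definition is symmetric in the two directions; this form suits
  calculations with \<open>opp\<close>.\<close>

lemma frame_iff: "frame v a b \<longleftrightarrow> v \<in> V \<and> a \<in> N v \<and> b \<in> N v \<and> b \<noteq> a \<and> b \<noteq> opp v a"
proof (cases "v \<in> V \<and> a \<in> N v \<and> b \<in> N v \<and> b \<noteq> a")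
  case True
  then have "v \<in> N a \<inter> N b" using N_sym by blast
  with True have "(\<exists>x. x \<noteq> v \<and> x \<in> N a \<inter> N b) \<longleftrightarrow> N a \<inter> N b \<noteq> {v}" by blast
  also have "\<dots> \<longleftrightarrow> b \<noteq> opp v a" using True opp opp_eqI by metis
  finally show ?thesis using True unfolding frame_def by blast
qed (auto simp: frame_def)

lemma frame_swap: "frame v a b \<Longrightarrow> frame v b a"
  by (auto simp: frame_def)

lemma frame_opp: "frame v a b \<Longrightarrow> frame v (opp v a) b"
  unfolding frame_iff using opp opp_opp by metis

lemma frame_exists:
  assumes "v \<in> V" "a \<in> N v"
  shows "\<exists>b. frame v a b"
proof -
  obtain b x where "b \<in> N v" "b \<noteq> a" "x \<noteq> v" "N a \<inter> N b = {v, x}"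
    using local_structure[OF assms] by auto
  with assms show ?thesis unfolding frame_def by blast
qed

text \<open>\<open>opp v\<close> is a fixed-point-free involution on \<open>N v\<close>, so the four
  listed neighbours are distinct; they exhaust \<open>N v\<close>, which has four elements.\<close>

lemma frame_N:
  assumes "frame v a b"
  shows "distinct [a, opp v a, b, opp v b]" "N v = {a, opp v a, b, opp v b}"
proof -
  have *: "v \<in> V" "a \<in> N v" "b \<in> N v" "b \<noteq> a" "b \<noteq> opp v a" using assms by (auto simp: frame_iff)
  then show d: "distinct [a, opp v a, b, opp v b]"
    using opp opp_opp by simp metis
  obtain p q r where "N v = {a, p, q, r}" "distinct [a, p, q, r]"
    using local_structure[OF *(1,2)] by blast
  then have "card (N v) = 4" "finite (N v)" by simp_all
  moreover have "{a, opp v a, b, opp v b} \<subseteq> N v" using * opp by simp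
  moreover have "card {a, opp v a, b, opp v b} = 4" using d by simp
  ultimately show "N v = {a, opp v a, b, opp v b}" by (metis card_subset_eq)
qed

lemma corner_ex1:
  assumes "frame v a b"
  shows "\<exists>!x. x \<noteq> v \<and> x \<in> N a \<inter> N b"
proof -
  have *: "v \<in> V" "a \<in> N v" "b \<in> N v" "b \<noteq> a" "N a \<inter> N b \<noteq> {v}"
    using assms by (auto simp: frame_def)
  obtain p q r where pqr: "N v = {a, p, q, r}" "N a \<inter> N q = {v}"
    and "\<exists>x. x \<noteq> v \<and> N a \<inter> N p = {v, x}" "\<exists>x. x \<noteq> v \<and> N a \<inter> N r = {v, x}"
    using local_structure[OF *(1,2)] by blast
  with * have "\<exists>x. x \<noteq> v \<and> N a \<inter> N b = {v, x}" by auto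
  then show ?thesis by blast
qed

lemma corner:
  assumes "frame v a b"
  shows "corner v a b \<noteq> v" "corner v a b \<in> N a" "corner v a b \<in> N b"
  using theI'[OF corner_ex1[OF assms], folded corner_def] by blast+

lemma corner_eqI: "frame v a b \<Longrightarrow> x \<noteq> v \<Longrightarrow> x \<in> N a \<Longrightarrow> x \<in> N b \<Longrightarrow> corner v a b = x"
  using corner_ex1 corner by blast

lemma corner_swap: "frame v a b \<Longrightarrow> corner v b a = corner v a b"
  by (rule corner_eqI[OF frame_swap]) (simp_all add: corner)

text \<open>The square on \<open>v\<close>, \<open>a\<close>, the corner and \<open>b\<close> is
  viewed from \<open>a\<close>: there \<open>v\<close> and the corner are the two sides, and
  \<open>b\<close> is the vertex across.\<close>

lemma frame_corner:
  assumes "frame v a b"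
  shows "frame a v (corner v a b)" "corner a v (corner v a b) = b"
proof -
  have *: "v \<in> V" "a \<in> N v" "b \<in> N v" "b \<noteq> a" using assms by (simp_all add: frame_iff)
  have b: "b \<in> N (corner v a b)" using corner(3)[OF assms] by (rule N_sym)
  have "a \<in> V" "v \<in> N a" using N_closed N_sym * by blast+
  then show f: "frame a v (corner v a b)"
    using * b corner(1,2)[OF assms] unfolding frame_def by auto
  show "corner a v (corner v a b) = b"
    using f * b by (intro corner_eqI)
qed

lemma frame_corner_swap:
  assumes "frame v a b"
  shows "frame b v (corner v a b)" "corner b v (corner v a b) = a"
  using frame_corner[OF frame_swap[OF assms]] corner_swap[OF assms] by simp_all

text \<open>
  The two squares that meet in the edge from \<open>v\<close> to \<open>b\<close>: both outer corners are
  neighbours of \<open>b\<close> perpendicular to \<open>v\<close>, and they differ since \<open>a\<close> and \<open>opp v a\<close> have only the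
  neighbour \<open>v\<close> in common.
\<close>

lemma corner_opp:
  assumes "frame v a b"
  shows "corner v (opp v a) b = opp b (corner v a b)"
proof -
  have f': "frame v (opp v a) b" using assms by (rule frame_opp)
  have g: "frame b v (corner v a b)"
    using assms by (rule frame_corner_swap)
  have g': "frame b v (corner v (opp v a) b)"
    using f' by (rule frame_corner_swap)
  have "corner v (opp v a) b \<noteq> corner v a b"
  proof
    assume "corner v (opp v a) b = corner v a b"
    then have "corner v a b \<in> N a \<inter> N (opp v a)"
      using corner(2)[OF assms] corner(2)[OF f'] by simp
    moreover have "N a \<inter> N (opp v a) = {v}" using assms opp(3) by (simp add: frame_iff)
    ultimately show False using corner(1)[OF assms] by blast
  qed
  moreover have "corner v (opp v a) b \<in> {v, opp b v, corner v a b, opp b (corner v a b)}"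
    using frame_N(2)[OF g] corner(3)[OF f'] by simp
  ultimately show ?thesis using g' by (auto simp: frame_iff)
qed

section \<open>Moves on frames\<close>

definition frames :: "('a \<times> 'a \<times> 'a) set" where
  "frames = {(v, a, b). frame v a b}"

definition flip :: "'a \<times> 'a \<times> 'a \<Rightarrow> 'a \<times> 'a \<times> 'a" where
  "flip = (\<lambda>(v, a, b). (v, opp v a, b))"

definition swap :: "'a \<times> 'a \<times> 'a \<Rightarrow> 'a \<times> 'a \<times> 'a" where
  "swap = (\<lambda>(v, a, b). (v, b, a))"

definition right :: "'a \<times> 'a \<times> 'a \<Rightarrow> 'a \<times> 'a \<times> 'a" where
  "right = (\<lambda>(v, a, b). (a, opp a v, corner v a b))"

text \<open>Conjugating \<open>right\<close> by \<open>swap\<close> lets facts such as injectivity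
  carry over from \<open>right\<close>.\<close>

definition up :: "'a \<times> 'a \<times> 'a \<Rightarrow> 'a \<times> 'a \<times> 'a" where
  "up f = swap (right (swap f))"

lemma swap_swap [simp]: "swap (swap f) = f"
  by (simp add: swap_def split: prod.split)

lemma fst_swap [simp]: "fst (swap f) = fst f" and fst_flip [simp]: "fst (flip f) = fst f"
  by (simp_all add: swap_def flip_def split: prod.split)

lemma flip_flip: "f \<in> frames \<Longrightarrow> flip (flip f) = f"
  by (auto simp: flip_def frames_def frame_def opp_opp)

lemma swap_frames: "f \<in> frames \<Longrightarrow> swap f \<in> frames"
  by (auto simp: swap_def frames_def frame_swap)

lemma flip_frames: "f \<in> frames \<Longrightarrow> flip f \<in> frames"
  by (auto simp: flip_def frames_def frame_opp)

lemma right_frames: "f \<in> frames \<Longrightarrow> right f \<in> frames"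
  by (auto simp: right_def frames_def intro: frame_opp frame_corner(1))

lemma up_frames: "f \<in> frames \<Longrightarrow> up f \<in> frames"
  by (simp add: up_def swap_frames right_frames)

lemma up_eq: "frame v a b \<Longrightarrow> up (v, a, b) = (b, corner v a b, opp b v)"
  by (simp add: up_def swap_def right_def corner_swap)

text \<open>After a step right, \<open>flip\<close> makes the frame look back at \<open>v\<close>,
  with the same corner as second direction. A second step right returns to \<open>v\<close>, where
  the corner is again \<open>b\<close>. Thus \<open>right\<close> is inverted by its conjugate under
  \<open>flip\<close>.\<close>

lemma flip_right_flip_right: "f \<in> frames \<Longrightarrow> flip (right (flip (right f))) = f"
proof -
  assume "f \<in> frames"
  then obtain v a b where f: "f = (v, a, b)" "frame v a b" by (auto simp: frames_def)
  have "flip (right f) = (a, v, corner v a b)"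
    using f frame_corner(1)[OF f(2)] by (simp add: flip_def right_def opp_opp frame_iff)
  then show ?thesis using f by (simp add: flip_def right_def frame_corner(2) opp_opp frame_iff)
qed

lemma right_flip_right: "f \<in> frames \<Longrightarrow> right (flip (right f)) = flip f"
  by (metis flip_right_flip_right flip_flip flip_frames right_frames)

text \<open>Both ways around the square end at the corner \<open>c\<close> with directions
  \<open>opp c b\<close> and \<open>opp c a\<close>. Each way produces one of these directly as an
  opposite and the other as a corner, which \<open>corner_opp\<close> identifies.\<close>

lemma up_right:
  assumes "f \<in> frames"
  shows "up (right f) = right (up f)"
proof -
  obtain v a b where f: "f = (v, a, b)" "frame v a b" using assms by (auto simp: frames_def)
  define c where "c = corner v a b"
  have g: "frame a v c" using frame_corner(1)[OF f(2)] by (simp add: c_def)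
  have h: "frame b v c"
    using frame_corner_swap(1)[OF f(2)] by (simp add: c_def)
  have "corner a v c = b" using frame_corner(2)[OF f(2)] by (simp add: c_def)
  moreover have "corner b v c = a"
    using frame_corner_swap(2)[OF f(2)] by (simp add: c_def)
  ultimately have "corner a (opp a v) c = opp c b" "corner b (opp b v) c = opp c a"
    using corner_opp[OF g] corner_opp[OF h] by simp_all
  then show ?thesis
    using f(2) frame_opp[OF g] corner_swap[OF frame_opp[OF h]] unfolding f(1)
    by (simp add: right_def up_eq flip: c_def)
qed

text \<open>By \<open>corner_opp\<close>, reversing the first direction at \<open>v\<close> also
  reverses it one step up.\<close>

lemma up_flip: "f \<in> frames \<Longrightarrow> up (flip f) = flip (up f)"
  by (auto simp: frames_def flip_def up_eq frame_opp corner_opp)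

section \<open>Existence and uniqueness of developments\<close>

text \<open>Only forward steps are prescribed; backward steps are then determined, since
  \<open>right\<close> and \<open>up\<close> are injective on frames.\<close>

definition development :: "(int ^ 2 \<Rightarrow> 'a \<times> 'a \<times> 'a) \<Rightarrow> bool" where
  "development F \<longleftrightarrow> (\<forall>z. F z \<in> frames \<and> F (z + e1) = right (F z) \<and> F (z + e2) = up (F z))"

lemma development_vertex:
  assumes "development F"
  shows "fst (F z) \<in> V"
proof -
  have "F z \<in> frames" using assms by (simp add: development_def)
  then show ?thesis by (auto simp: frames_def frame_def)
qed

lemma development_exists:
  assumes "f \<in> frames"
  shows "\<exists>F. development F \<and> F 0 = f"
proof -
  \<comment> \<open>\<open>left\<close> and \<open>down\<close> are to invert \<open>right\<close>
    and \<open>up\<close> on frames; the inversion facts follow below.\<close>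
  define left where "left f = flip (right (flip f))" for f
  define down where "down f = swap (left (swap f))" for f
  have closed: "right \<in> frames \<rightarrow> frames" "left \<in> frames \<rightarrow> frames" "up \<in> frames \<rightarrow> frames"
      "down \<in> frames \<rightarrow> frames"
    by (auto simp: left_def down_def right_frames flip_frames up_frames swap_frames)
  have inv: "left (right f) = f" "right (left f) = f" if "f \<in> frames" for f
    using that by (simp_all add: left_def flip_right_flip_right right_flip_right flip_flip flip_frames)
  have inv': "up (down f) = f" if "f \<in> frames" for f
    using that by (simp add: up_def down_def inv swap_frames)
  \<comment> \<open>The vertical power is applied first, so the rule for \<open>e1\<close> is
    immediate; the rule for \<open>e2\<close> needs \<open>up\<close> to commute with powers of
    \<open>right\<close>.\<close>
  define F where "F z = int_pow right left (z $ 1) (int_pow up down (z $ 2) f)" for z :: "int ^ 2"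
  have col: "int_pow up down n f \<in> frames" for n
    using closed assms by (simp add: int_pow_closed)
  have "F z \<in> frames" for z
    using closed col by (simp add: F_def int_pow_closed)
  moreover have "F (z + e1) = right (F z)" for z
    using int_pow_plus_1[OF closed(2) inv(2) col] by (simp add: F_def)
  moreover have "F (z + e2) = up (F z)" for z
    using int_pow_plus_1[OF closed(4) inv' assms]
      int_pow_commute[OF closed(1,2,3) inv up_right col] by (simp add: F_def)
  moreover have "F 0 = f" by (simp add: F_def int_pow_def)
  ultimately show ?thesis unfolding development_def by blast
qed

lemma inj_right: "inj_on right frames"
  by (metis flip_right_flip_right inj_onI)

lemma inj_up: "inj_on up frames"
  by (rule inj_onI) (metis up_def swap_swap swap_frames inj_right inj_onD)

text \<open>Agreement spreads forward by the defining equations and backward by injectivity of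
  \<open>right\<close> and \<open>up\<close>.\<close>

lemma development_unique:
  assumes "development F" "development F'" "F 0 = F' 0"
  shows "F z = F' z"
proof (induction z rule: lattice_induct)
  case (left z)
  have "right (F (z - e1)) = right (F' (z - e1))"
    using assms(1,2) left unfolding development_def by (metis diff_add_cancel)
  then show ?case using assms(1,2) inj_onD[OF inj_right] unfolding development_def by blast
next
  case (down z)
  have "up (F (z - e2)) = up (F' (z - e2))"
    using assms(1,2) down unfolding development_def by (metis diff_add_cancel)
  then show ?case using assms(1,2) inj_onD[OF inj_up] unfolding development_def by blast
qed (use assms in \<open>auto simp: development_def\<close>)

section \<open>Symmetries of developments\<close>

lemma development_translate:
  assumes "development F"
  shows "development (\<lambda>z. F (u + z))"
  using assms unfolding development_def by (metis add.assoc)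

lemma development_swap:
  assumes "development F"
  shows "development (\<lambda>z. swap (F (pt (z $ 2) (z $ 1))))"
proof -
  have "pt (z $ 2) (z $ 1 + 1) = pt (z $ 2) (z $ 1) + e2"
    "pt (z $ 2 + 1) (z $ 1) = pt (z $ 2) (z $ 1) + e1" for z :: "int ^ 2"
    by (simp_all add: vec_eq_2)
  then show ?thesis
    using assms unfolding development_def by (simp add: swap_frames up_def)
qed

lemma development_flip:
  assumes "development F"
  shows "development (\<lambda>z. flip (F (pt (- z $ 1) (z $ 2))))"
proof -
  \<comment> \<open>Reflection turns a step left into a step right.\<close>
  have "flip (F (y - e1)) = right (flip (F y))" for y
    using assms right_flip_right unfolding development_def by (metis diff_add_cancel)
  moreover have "pt (- (z + e1) $ 1) ((z + e1) $ 2) = pt (- z $ 1) (z $ 2) - e1"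
    "pt (- (z + e2) $ 1) ((z + e2) $ 2) = pt (- z $ 1) (z $ 2) + e2" for z
    by (simp_all add: vec_eq_2)
  ultimately show ?thesis
    using assms unfolding development_def by (simp only: flip_frames up_flip) simp
qed

text \<open>The eight frames at a vertex are obtained from any one of them by \<open>swap\<close>
  and \<open>flip\<close>. The corresponding lattice symmetries fix the origin, so the frame there
  can be changed to any other at the same vertex while the underlying map changes only by a lattice
  automorphism.\<close>

lemma development_realign:
  assumes F: "development F" and g: "g \<in> frames" "fst g = fst (F 0)"
  shows "\<exists>F' \<phi>. development F' \<and> F' 0 = g \<and> lattice_automorphism \<phi> \<and> \<phi> 0 = 0 \<and>
    (\<forall>z. fst (F' z) = fst (F (\<phi> z)))"
proof -
  define P where "P g \<longleftrightarrow> (\<exists>F' \<phi>. development F' \<and> F' 0 = g \<and> lattice_automorphism \<phi> \<and> \<phi> 0 = 0 \<and>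
    (\<forall>z. fst (F' z) = fst (F (\<phi> z))))" for g
  have pt0: "pt 0 0 = 0" by (simp add: vec_eq_2)
  have "lattice_automorphism (\<lambda>z. z)"
    using lattice_automorphism_translate[of 0] by simp
  then have base: "P (F 0)"
    unfolding P_def using F by (intro exI[of _ F] exI[of _ "\<lambda>z. z"]) simp
  have swap: "P (swap g)" if "P g" for g
  proof -
    obtain F' \<phi> where *: "development F'" "F' 0 = g" "lattice_automorphism \<phi>" "\<phi> 0 = 0"
      "\<forall>z. fst (F' z) = fst (F (\<phi> z))" using \<open>P g\<close> unfolding P_def by blast
    show ?thesis unfolding P_def
      using * development_swap[OF *(1)] graph_isomorphism_comp[OF lattice_automorphism_swap *(3)]
      by (intro exI[of _ "\<lambda>z. swap (F' (pt (z $ 2) (z $ 1)))"]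
          exI[of _ "\<lambda>z. \<phi> (pt (z $ 2) (z $ 1))"]) (simp add: pt0)
  qed
  have flip: "P (flip g)" if "P g" for g
  proof -
    obtain F' \<phi> where *: "development F'" "F' 0 = g" "lattice_automorphism \<phi>" "\<phi> 0 = 0"
      "\<forall>z. fst (F' z) = fst (F (\<phi> z))" using \<open>P g\<close> unfolding P_def by blast
    show ?thesis unfolding P_def
      using * development_flip[OF *(1)] graph_isomorphism_comp[OF lattice_automorphism_flip *(3)]
      by (intro exI[of _ "\<lambda>z. flip (F' (pt (- z $ 1) (z $ 2)))"]
          exI[of _ "\<lambda>z. \<phi> (pt (- z $ 1) (z $ 2))"]) (simp add: pt0)
  qed
  obtain v a b c d where F0: "F 0 = (v, a, b)" and g': "g = (v, c, d)"
    using g(2) by (metis fst_conv surj_pair)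
  have f: "frame v a b"
    using F F0 unfolding development_def frames_def by (metis case_prodD mem_Collect_eq)
  have N: "N v = {a, opp v a, b, opp v b}" "v \<in> V" "a \<in> N v" "b \<in> N v"
    using f frame_N(2)[OF f] by (simp_all add: frame_iff)
  \<comment> \<open>Closure of \<open>P\<close> under both moves leads from \<open>(v, a, b)\<close>
    to all frames at \<open>v\<close>.\<close>
  have "P (v, y, x)" "P (v, opp v x, y)" if "P (v, x, y)" for x y
    using swap[OF that] flip[OF that] by (simp_all add: swap_def flip_def)
  moreover have "P (v, a, b)" using base F0 by simp
  ultimately have "P (v, x, y) \<and> P (v, y, x)" if "x \<in> {a, opp v a}" "y \<in> {b, opp v b}" for x y
    using that by blast
  moreover have "c \<in> N v" "d \<in> N v" "d \<noteq> c" "d \<noteq> opp v c"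
    using g(1) g' by (auto simp: frames_def frame_iff)
  ultimately have "P (v, c, d)"
    using opp_opp[OF N(2,3)] opp_opp[OF N(2,4)] unfolding N(1)
    by (elim insertE emptyE) simp_all
  then show ?thesis by (simp add: P_def g')
qed

text \<open>The development recentred at \<open>v\<close> is realigned to have the frame
  \<open>F u\<close> at the origin. By uniqueness it is then the development recentred at
  \<open>u\<close>, so the wanted automorphism sends \<open>u + z\<close> to
  \<open>v + \<phi> z\<close>.\<close>

lemma development_automorphism:
  assumes F: "development F" and "fst (F u) = fst (F v)"
  shows "\<exists>\<psi>. lattice_automorphism \<psi> \<and> \<psi> u = v \<and> (\<forall>z. fst (F (\<psi> z)) = fst (F z))"
proof -
  have "F u \<in> frames" using F by (simp add: development_def)
  then obtain F' \<phi> where *: "development F'" "F' 0 = F u" "lattice_automorphism \<phi>" "\<phi> 0 = 0"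
      "\<And>z. fst (F' z) = fst (F (v + \<phi> z))"
    using development_realign[OF development_translate[OF F, of v], of "F u"] assms(2) by auto
  have F': "F' z = F (u + z)" for z
    using development_unique[OF *(1) development_translate[OF F, of u]] *(2) by simp
  have "fst (F (\<phi> (z + - u) + v)) = fst (F z)" for z
    using *(5)[of "z - u"] F'[of "z - u"] by (simp add: add.commute)
  moreover have "lattice_automorphism (\<lambda>z. \<phi> (z + - u) + v)"
    by (intro graph_isomorphism_comp[OF _ lattice_automorphism_translate]
        graph_isomorphism_comp[OF lattice_automorphism_translate] *(3))
  ultimately show ?thesis using *(4) by (intro exI[of _ "\<lambda>z. \<phi> (z + - u) + v"]) simp
qed

text \<open>The four lattice neighbours go to the two directions of the frame and their opposites,
  which are all the neighbours by \<open>frame_N\<close>.\<close>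

lemma development_bij_betw:
  assumes "development F"
  shows "bij_betw (\<lambda>z. fst (F z)) (neighbours lattice_graph z) (N (fst (F z)))"
proof -
  have fr: "F y \<in> frames" and R: "F (y + e1) = right (F y)" and U: "F (y + e2) = up (F y)" for y
    using assms by (simp_all add: development_def)
  obtain v a b where Fz: "F z = (v, a, b)" by (metis surj_pair)
  then have f: "frame v a b" using fr[of z] by (simp add: frames_def)
  obtain w c d where w: "F (z - e1) = (w, c, d)" by (metis surj_pair)
  have "frame w c d" using fr[of "z - e1"] w by (simp add: frames_def)
  moreover have "right (w, c, d) = (v, a, b)" using R[of "z - e1"] w Fz by simp
  \<comment> \<open>The step from \<open>z - e1\<close> to \<open>z\<close> goes straight on at
    \<open>v\<close>, so the vertex left behind lies opposite the new first direction.\<close>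
  ultimately have "w \<in> N v" "a = opp v w"
    using N_sym[of c w] by (auto simp: right_def frame_iff)
  then have left: "opp v a = w" using f by (simp add: frame_iff opp_opp)
  obtain w' c' d' where w': "F (z - e2) = (w', c', d')" by (metis surj_pair)
  have f': "frame w' c' d'" using fr[of "z - e2"] w' by (simp add: frames_def)
  moreover have "up (w', c', d') = (v, a, b)" using U[of "z - e2"] w' Fz by simp
  ultimately have "w' \<in> N v" "b = opp v w'"
    using N_sym[of d' w'] by (auto simp: up_eq[OF f'] frame_iff)
  then have down: "opp v b = w'" using f by (simp add: frame_iff opp_opp)
  have "fst (F (z + e1)) = a" "fst (F (z - e1)) = opp v a" "fst (F (z + e2)) = b"
    "fst (F (z - e2)) = opp v b"
    using R[of z] U[of z] Fz w w' left down f by (simp_all add: right_def up_eq)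
  then show ?thesis
    using frame_N[OF f] unfolding neighbours_lattice Fz bij_betw_def by (auto simp: inj_on_def)
qed

end

section \<open>From links to the local grid structure\<close>

lemma graph_dist_self:
  assumes "pair_bidirected_digraph G" "v \<in> pverts G"
  shows "graph_dist G v v \<le> 0"
proof -
  interpret pair_bidirected_digraph G by fact
  have "awalk v [] v" using assms(2) by (simp add: awalk_def)
  then show ?thesis using graph_dist_le_iff[OF assms(1), of v v 0]
    by (fastforce simp: zero_ereal_def)
qed

lemma graph_dist_adjacent:
  assumes "pair_bidirected_digraph G" "(v, a) \<in> parcs G"
  shows "graph_dist G v a \<le> 1"
proof -
  interpret pair_bidirected_digraph G by fact
  have "awalk v [(v, a)] a" using assms(2) in_arcsD1 by (auto simp: awalk_def)
  then show ?thesis using graph_dist_le_iff[OF assms(1), of v a 1]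
    by (fastforce simp: one_ereal_def)
qed

lemma graph_dist_path2:
  assumes "pair_bidirected_digraph G" "(v, a) \<in> parcs G" "(a, x) \<in> parcs G"
  shows "graph_dist G v x \<le> 2"
proof -
  interpret pair_bidirected_digraph G by fact
  have "awalk v [(v, a), (a, x)] x" using assms(2,3) in_arcsD1 by (auto simp: awalk_def)
  then have "graph_dist G v x \<le> ereal (real 2)"
    unfolding graph_dist_le_iff[OF assms(1)] by (intro exI[of _ "[(v, a), (a, x)]"]) simp
  then show ?thesis by simp
qed

text \<open>\<open>v\<close> and its neighbours lie at distance at most one, hence below the radius,
  so the link keeps every edge at them.\<close>

lemma neighbours_link_minus:
  assumes "pair_bidirected_digraph G" "v \<in> pverts G" "x = v \<or> x \<in> neighbours G v"
  shows "neighbours (link_minus 2 v G) x = neighbours G x"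
    "insert x (neighbours G x) \<subseteq> pverts (link_minus 2 v G)"
proof -
  interpret pair_bidirected_digraph G by fact
  have "graph_dist G v x \<le> 1"
    using assms graph_dist_self[OF assms(1,2)] graph_dist_adjacent[OF assms(1)]
    by (auto simp: neighbours_def intro: order_trans)
  then have x: "graph_dist G v x < 2" by (rule le_less_trans) simp
  then show "neighbours (link_minus 2 v G) x = neighbours G x"
    by (auto simp: neighbours_def link_minus_def min_less_iff_disj)
  have "graph_dist G v y \<le> 2" if "y \<in> neighbours G x" for y
    using assms that graph_dist_adjacent[OF assms(1), of v y] graph_dist_path2[OF assms(1), of v x y]
    by (auto simp: neighbours_def intro: order_trans)
  moreover have "x \<in> pverts G" "neighbours G x \<subseteq> pverts G"
    using assms in_arcsD2 by (auto simp: neighbours_def)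
  ultimately show "insert x (neighbours G x) \<subseteq> pverts (link_minus 2 v G)"
    using x by (auto simp: link_minus_def)
qed

text \<open>\<open>graph_isomorphism\<close> compares arcs only between vertices, which is why both
  neighbour sets must consist of vertices.\<close>

lemma neighbours_isomorphism:
  assumes "graph_isomorphism F H \<phi>" "x \<in> pverts F"
    and "neighbours F x \<subseteq> pverts F" "neighbours H (\<phi> x) \<subseteq> pverts H"
  shows "neighbours H (\<phi> x) = \<phi> ` neighbours F x"
proof -
  have img: "pverts H = \<phi> ` pverts F"
    using assms(1) by (simp add: graph_isomorphism_def bij_betw_def)
  have arc: "(x, y) \<in> parcs F \<longleftrightarrow> (\<phi> x, \<phi> y) \<in> parcs H" if "y \<in> pverts F" for y
    using assms(1,2) that by (simp add: graph_isomorphism_def)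
  show ?thesis
  proof (intro equalityI subsetI)
    fix w assume w: "w \<in> neighbours H (\<phi> x)"
    then obtain y where "y \<in> pverts F" "w = \<phi> y" using assms(4) img by blast
    then show "w \<in> \<phi> ` neighbours F x" using w arc by (simp add: neighbours_def)
  next
    fix w assume "w \<in> \<phi> ` neighbours F x"
    then obtain y where "y \<in> neighbours F x" "w = \<phi> y" by blast
    then show "w \<in> neighbours H (\<phi> x)" using assms(3) arc by (auto simp: neighbours_def)
  qed
qed

lemma neighbours_link_isomorphism:
  fixes F :: "'a pair_pre_digraph" and H :: "'b pair_pre_digraph"
  assumes "pair_bidirected_digraph F" "pair_bidirected_digraph H" "u \<in> pverts F" "v \<in> pverts H"
    and "graph_isomorphism (link_minus 2 u F) (link_minus 2 v H) \<phi>" "\<phi> u = v"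
    and "x = u \<or> x \<in> neighbours F u"
  shows "neighbours H (\<phi> x) = \<phi> ` neighbours F x"
proof -
  \<comment> \<open>This is applied first at the centre; the result shows that neighbours of
    \<open>u\<close> go to neighbours of \<open>v\<close>, so it applies to them as well.\<close>
  have step: "neighbours H (\<phi> x) = \<phi> ` neighbours F x"
    if "x = u \<or> x \<in> neighbours F u" "\<phi> x = v \<or> \<phi> x \<in> neighbours H v" for x
    using neighbours_isomorphism[OF assms(5), of x]
      neighbours_link_minus[OF assms(1,3) that(1)] neighbours_link_minus[OF assms(2,4) that(2)]
    by simp
  have "neighbours H v = \<phi> ` neighbours F u" using step[of u] assms(6) by simp
  then show ?thesis using step assms(6,7) by blast
qed

lemma weakly_locally_lattice_local_grid:
  fixes G :: "'a pair_pre_digraph"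
  assumes G: "pair_bidirected_digraph G" and "weakly_locally_lattice TYPE(2) 2 G"
  shows "local_grid (pverts G) (neighbours G)"
proof
  interpret pair_bidirected_digraph G by fact
  show "a \<in> pverts G" if "a \<in> neighbours G v" for v a
    using that in_arcsD2 by (auto simp: neighbours_def)
  show "v \<in> neighbours G a" if "a \<in> neighbours G v" for v a
    using that arcs_symmetric by (auto simp: neighbours_def)
  let ?L = "lattice_graph :: (int ^ 2) pair_pre_digraph"
  note L = pair_bidirected_digraph_lattice_graph
  have iso: "\<exists>\<phi>. graph_isomorphism (link_minus 2 0 ?L) (link_minus 2 v G) \<phi> \<and> \<phi> 0 = v \<and>
      (\<forall>x. x = 0 \<or> x \<in> neighbours ?L 0 \<longrightarrow> neighbours G (\<phi> x) = \<phi> ` neighbours ?L x)"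
    if "v \<in> pverts G" for v
    using assms(2) neighbours_link_isomorphism[OF L G _ that] that
    unfolding weakly_locally_lattice_def by (metis UNIV_I pverts_lattice)
  show "neighbours G v \<noteq> {}" if v: "v \<in> pverts G" for v
    using iso[OF v] unfolding neighbours_lattice by (metis empty_iff image_is_empty insertI1)
  fix v a assume v: "v \<in> pverts G" and a: "a \<in> neighbours G v"
  obtain \<phi> where \<phi>: "graph_isomorphism (link_minus 2 0 ?L) (link_minus 2 v G) \<phi>" "\<phi> 0 = v"
    and N: "\<And>x. x = 0 \<or> x \<in> neighbours ?L 0 \<Longrightarrow> neighbours G (\<phi> x) = \<phi> ` neighbours ?L x"
    using iso[OF v] by blast
  \<comment> \<open>\<open>D\<close> contains the lattice neighbours of the origin and of each of
    its neighbours, so injectivity of \<open>\<phi>\<close> on \<open>D\<close> makes images respect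
    common neighbourhoods.\<close>
  define D where "D = pverts (link_minus 2 0 ?L)"
  have inj: "inj_on \<phi> D"
    using \<phi>(1) by (simp add: graph_isomorphism_def bij_betw_def D_def)
  have D: "insert x (neighbours ?L x) \<subseteq> D" if "x = 0 \<or> x \<in> neighbours ?L 0" for x
    using neighbours_link_minus(2)[OF L _ that] by (simp add: D_def)
  obtain e where e: "e \<in> neighbours ?L 0" "a = \<phi> e"
    using a N[of 0] \<phi>(2) by auto
  obtain f where N0: "neighbours ?L 0 = {e, f, - e, - f}" "distinct [e, f, - e, - f]"
    and ef: "neighbours ?L e \<inter> neighbours ?L f = {0, e + f}" "e + f \<noteq> 0"
    and ee: "neighbours ?L e \<inter> neighbours ?L (- e) = {0}"
    and ef': "neighbours ?L e \<inter> neighbours ?L (- f) = {0, e - f}" "e - f \<noteq> 0"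
    using e(1) by (rule lattice_local_structure)
  have common: "neighbours G (\<phi> x) \<inter> neighbours G (\<phi> y) = \<phi> ` (neighbours ?L x \<inter> neighbours ?L y)"
    if "x \<in> neighbours ?L 0" "y \<in> neighbours ?L 0" for x y
    using N D that inj_on_image_Int[OF inj, of "neighbours ?L x" "neighbours ?L y"] by simp
  have in0: "e \<in> neighbours ?L 0" "f \<in> neighbours ?L 0" "- e \<in> neighbours ?L 0" "- f \<in> neighbours ?L 0"
    using N0(1) by simp_all
  have inD: "0 \<in> D" "e \<in> D" "f \<in> D" "- e \<in> D" "- f \<in> D" "e + f \<in> D" "e - f \<in> D"
    using D[of 0] D[of e] N0(1) ef(1) ef'(1) by auto
  note \<phi>_eq = inj_on_eq_iff[OF inj]
  have "distinct [\<phi> e, \<phi> f, \<phi> (- e), \<phi> (- f)]"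
    using N0(2) inD by (simp add: \<phi>_eq)
  moreover have "neighbours G v = {\<phi> e, \<phi> f, \<phi> (- e), \<phi> (- f)}"
    using N[of 0] N0(1) \<phi>(2) by simp
  moreover have "neighbours G (\<phi> e) \<inter> neighbours G (\<phi> (- e)) = {v}"
    "neighbours G (\<phi> e) \<inter> neighbours G (\<phi> f) = {v, \<phi> (e + f)}"
    "neighbours G (\<phi> e) \<inter> neighbours G (\<phi> (- f)) = {v, \<phi> (e - f)}"
    using common in0 ee ef(1) ef'(1) \<phi>(2) by simp_all
  moreover have "\<phi> (e + f) \<noteq> v" "\<phi> (e - f) \<noteq> v"
    using \<phi>_eq[of _ 0] inD ef(2) ef'(2) \<phi>(2) by auto
  ultimately show "\<exists>b c d. distinct [a, b, c, d] \<and> neighbours G v = {a, b, c, d} \<and>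
      neighbours G a \<inter> neighbours G c = {v} \<and>
      (\<exists>x. x \<noteq> v \<and> neighbours G a \<inter> neighbours G b = {v, x}) \<and>
      (\<exists>x. x \<noteq> v \<and> neighbours G a \<inter> neighbours G d = {v, x})"
    unfolding e(2) by blast
qed

section \<open>The covering map\<close>

theorem theorem1:
  fixes G :: "'a pair_pre_digraph"
  assumes "pair_bidirected_digraph G"
    and "Digraph_Component.connected (with_proj G)"
    and "weakly_locally_lattice TYPE(2) 2 G"
  shows "\<exists>p. normal_covering_map (lattice_graph :: (int ^ 2) pair_pre_digraph) G p"
proof -
  interpret local_grid "pverts G" "neighbours G"
    using assms(1,3) by (rule weakly_locally_lattice_local_grid)
  \<comment> \<open>Connectedness includes nonemptiness, which supplies a vertex for the initial
    frame.\<close>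
  have "pverts G \<noteq> {}"
    using assms(2) by (auto simp: connected_def strongly_connected_def)
  then obtain v where v: "v \<in> pverts G" by blast
  obtain a where a: "a \<in> neighbours G v"
    using N_nonempty[OF v] by blast
  obtain b where "frame v a b"
    using frame_exists[OF v a] by blast
  then obtain F where F: "development F"
    using development_exists[of "(v, a, b)"] by (auto simp: frames_def)
  let ?p = "\<lambda>z. fst (F z)"
  have vert: "?p z \<in> pverts G" for z
    using F by (rule development_vertex)
  have bij: "bij_betw ?p (neighbours lattice_graph z) (neighbours G (?p z))" for z
    using F by (rule development_bij_betw)
  have "(?p x, ?p y) \<in> parcs G" if "(x, y) \<in> parcs lattice_graph" for x y
    using bij_betwE[OF bij[of x]] that by (simp add: neighbours_def)
  then have "covering_map lattice_graph G ?p"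
    using vert bij by (auto simp: covering_map_def graph_homomorphism_def)
  moreover have "\<exists>\<psi>. covering_transformation lattice_graph ?p \<psi> \<and> \<psi> x = y" if "?p x = ?p y" for x y
    using development_automorphism[OF F that] by (auto simp: covering_transformation_def)
  ultimately show ?thesis unfolding normal_covering_map_def by auto
qed

end
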